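(* Let $n\ge 2$. For real numbers $a_1,a_2,\dots,a_n$ and real numbers $x_1,x_2,\dots,x_n$ with $x_1+x_2+\cdots+x_n=0$, we have $$\frac{1}{n!}\sum_{\sigma}\max_{1\le k\le n}\left|\sum_{i=1}^k a_i x_{\sigma(i)}\right|^2\le\left(80+\frac{4}{205}\right)\frac{1}{n-1}\sum_{i=1}^n a_i^2\sum_{i=1}^n x_i^2,$$ where the sum on the left is taken over all permutations $\sigma$ of $\{1,\dots,n\}$.
   Context: The $a_i$ and the $x_i$ need not be distinct. *)

theory Defs
  imports Complex_Main "HOL-Combinatorics.Permutations"
begin

end

theory Submission
  imports Defs "HOL-Analysis.Convex"
begin

text \<open>
  Read off one value at a time, a uniformly random permutation \<open>\<sigma>\<close> turns the centred sequence \<open>x\<close>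
  into partial sums with drift: given the first \<open>k - 1\<close> values, \<open>x (\<sigma> k)\<close> has conditional mean
  \<open>- (\<Sum>j<k. x (\<sigma> j)) / (n + 1 - k)\<close>. Subtracting it leaves martingale differences. Over the first
  half of the indices Doob's \<open>L\<^sup>2\<close> inequality controls the martingale part and Cauchy--Schwarz
  the drift, which together give the constant 10. The second half is the first half of the reversed
  sequence, and if \<open>A\<close> and \<open>B\<close> are the two maxima, the overall one is at most \<open>A + 2 B\<close>, so its
  square is at most \<open>2 A\<^sup>2 + 8 B\<^sup>2\<close>; this yields the constant 80.
\<close>

section \<open>Running maxima, Doob's inequality along a single path, and predictability\<close>

definition running_max :: "(nat \<Rightarrow> real) \<Rightarrow> nat \<Rightarrow> real" where
  "running_max f k = Max ((\<lambda>i. \<bar>f i\<bar>) ` {..k})"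

lemma running_max_0 [simp]: "running_max f 0 = \<bar>f 0\<bar>"
  by (simp add: running_max_def)

lemma running_max_Suc: "running_max f (Suc k) = max \<bar>f (Suc k)\<bar> (running_max f k)"
  by (simp add: running_max_def atMost_Suc)

lemma abs_le_running_max: "i \<le> k \<Longrightarrow> \<bar>f i\<bar> \<le> running_max f k"
  by (simp add: running_max_def)

lemma running_max_nonneg: "0 \<le> running_max f k"
  using abs_le_running_max[of 0 k f] by linarith

lemma running_max_attained:
  obtains i where "i \<le> k" "running_max f k = \<bar>f i\<bar>"
proof -
  have "running_max f k \<in> (\<lambda>i. \<bar>f i\<bar>) ` {..k}"
    unfolding running_max_def by (intro Max_in) auto
  then show thesis using that by auto
qed

lemma running_max_cong: "(\<And>i. i \<le> k \<Longrightarrow> f i = g i) \<Longrightarrow> running_max f k = running_max g k"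
  unfolding running_max_def by (intro arg_cong[where f = Max] image_cong) auto

text \<open>This is the deterministic core of Doob's inequality: for a martingale, the left side is
  a transform with predictable weights and so averages to zero. In the induction the terms in
  \<open>\<bar>f k\<bar>\<close> cancel, which leaves a comparison of the old and the new running
  maximum.\<close>

lemma doob_pathwise:
  "(\<Sum>i<k. running_max f i * sgn (f i) * (f (Suc i) - f i))
     \<le> running_max f k * \<bar>f k\<bar> - (running_max f k)\<^sup>2 / 2"
proof (induction k)
  case 0
  show ?case by (simp add: power2_eq_square)
next
  case (Suc k)
  let ?R = "running_max f k" and ?R' = "running_max f (Suc k)"
  have "?R * sgn (f k) * (f (Suc k) - f k) = ?R * (sgn (f k) * f (Suc k)) - ?R * \<bar>f k\<bar>"
    by (simp add: algebra_simps abs_sgn)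
  also have "?R * (sgn (f k) * f (Suc k)) \<le> ?R * \<bar>f (Suc k)\<bar>"
    by (intro mult_left_mono running_max_nonneg) (auto simp: sgn_if)
  also have "?R * \<bar>f (Suc k)\<bar> \<le> ?R' * \<bar>f (Suc k)\<bar> - ?R'\<^sup>2 / 2 + ?R\<^sup>2 / 2"
  proof (cases "\<bar>f (Suc k)\<bar> \<le> ?R")
    case True
    then show ?thesis by (simp add: running_max_Suc max_def)
  next
    case False
    then have "?R' = \<bar>f (Suc k)\<bar>" by (simp add: running_max_Suc)
    \<comment> \<open>At a new record m = \<open>\<bar>f (Suc k)\<bar>\<close> the claim becomes R m
      <= m^2/2 + R^2/2.\<close>
    moreover have "0 \<le> (\<bar>f (Suc k)\<bar> - ?R)\<^sup>2" by simp
    ultimately show ?thesis by (simp add: power2_eq_square algebra_simps)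
  qed
  finally show ?case using Suc.IH by simp
qed

text \<open>Measurability with respect to the values before time k, without a sigma-algebra. The
  index 0 among the i < k carries no information, because every permutation of \<open>{1..n}\<close>
  fixes it.\<close>

definition predictable :: "nat \<Rightarrow> ((nat \<Rightarrow> nat) \<Rightarrow> real) \<Rightarrow> bool" where
  "predictable k h \<longleftrightarrow> (\<forall>\<sigma> \<tau>. (\<forall>i<k. \<sigma> i = \<tau> i) \<longrightarrow> h \<sigma> = h \<tau>)"

section \<open>Innovations of a uniformly random permutation\<close>

locale centred_sequence =
  fixes n :: nat and x :: "nat \<Rightarrow> real"
  assumes sum_zero: "(\<Sum>i = 1..n. x i) = 0"
begin

abbreviation perms :: "(nat \<Rightarrow> nat) set" where
  "perms \<equiv> {\<sigma>. \<sigma> permutes {1..n}}"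

definition cond_mean :: "(nat \<Rightarrow> nat) \<Rightarrow> nat \<Rightarrow> real" where
  "cond_mean \<sigma> k = - (\<Sum>j = 1..<k. x (\<sigma> j)) / (real n + 1 - real k)"

definition innov :: "(nat \<Rightarrow> nat) \<Rightarrow> nat \<Rightarrow> real" where
  "innov \<sigma> k = x (\<sigma> k) - cond_mean \<sigma> k"

definition mart :: "(nat \<Rightarrow> real) \<Rightarrow> (nat \<Rightarrow> nat) \<Rightarrow> nat \<Rightarrow> real" where
  "mart c \<sigma> k = (\<Sum>i = 1..k. c i * innov \<sigma> i)"

definition psum :: "(nat \<Rightarrow> real) \<Rightarrow> (nat \<Rightarrow> nat) \<Rightarrow> nat \<Rightarrow> real" where
  "psum c \<sigma> k = (\<Sum>i = 1..k. c i * x (\<sigma> i))"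

text \<open>Expectations appear throughout as plain sums over \<open>perms\<close>, so this is n!
  times the second moment of a single value \<open>x (\<sigma> k)\<close>; see
  \<open>sum_x_squared\<close>.\<close>

definition msq :: real where
  "msq = fact n / real n * (\<Sum>i = 1..n. (x i)\<^sup>2)"

lemma msq_nonneg: "0 \<le> msq"
  by (simp add: msq_def sum_nonneg)

lemma cond_mean_cong: "(\<And>i. i < k \<Longrightarrow> \<sigma> i = \<tau> i) \<Longrightarrow> cond_mean \<sigma> k = cond_mean \<tau> k"
  unfolding cond_mean_def by (intro arg_cong2[where f = "(/)"] arg_cong[where f = uminus] sum.cong) auto

lemma innov_cong: "(\<And>i. i \<le> k \<Longrightarrow> \<sigma> i = \<tau> i) \<Longrightarrow> innov \<sigma> k = innov \<tau> k"
  unfolding innov_def using cond_mean_cong[of k \<sigma> \<tau>] by simp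

lemma mart_cong: "(\<And>i. i \<le> k \<Longrightarrow> \<sigma> i = \<tau> i) \<Longrightarrow> mart c \<sigma> k = mart c \<tau> k"
  unfolding mart_def by (intro sum.cong refl arg_cong[where f = "(*) _"] innov_cong) auto

text \<open>Exchangeability of the values not yet seen: composing on the right with the
  transposition of k and j is a bijection of \<open>perms\<close> that leaves all values before k
  alone, hence also \<open>h\<close>.\<close>

lemma sum_perms_exchange:
  assumes h: "predictable k h" and "k \<in> {1..n}" "j \<in> {k..n}"
  shows "(\<Sum>\<sigma>\<in>perms. h \<sigma> * g (\<sigma> j)) = (\<Sum>\<sigma>\<in>perms. h \<sigma> * g (\<sigma> k))"
proof -
  let ?t = "Transposition.transpose k j"
  have t: "?t permutes {1..n}"
    using assms by (intro permutes_swap_id) auto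
  have "h (\<sigma> \<circ> ?t) = h \<sigma>" for \<sigma>
  proof -
    have "\<forall>i<k. (\<sigma> \<circ> ?t) i = \<sigma> i"
      using assms(3) by (auto simp: Transposition.transpose_def)
    then show ?thesis using h unfolding predictable_def by blast
  qed
  then show ?thesis
    using sum_permutations_compose_right[OF t, of "\<lambda>\<sigma>. h \<sigma> * g (\<sigma> j)"] by simp
qed

text \<open>Centring enters here: minus the sum of the values already seen is the sum of those still
  to come, and there are n + 1 - k of them.\<close>

lemma cond_mean_eq_mean_of_rest:
  assumes "\<sigma> \<in> perms" "k \<in> {1..n}"
  shows "(real n + 1 - real k) * cond_mean \<sigma> k = (\<Sum>j = k..n. x (\<sigma> j))"
proof -
  have "(\<Sum>j = 1..n. x (\<sigma> j)) = 0"
    using sum.permute[of \<sigma> "{1..n}" x] assms(1) sum_zero by (simp add: comp_def)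
  moreover have "{1..n} = {1..<k} \<union> {k..n}" using assms(2) by auto
  ultimately have "(\<Sum>j = 1..<k. x (\<sigma> j)) + (\<Sum>j = k..n. x (\<sigma> j)) = 0"
    by (simp add: sum.union_disjoint ivl_disj_int)
  then show ?thesis using assms(2) by (simp add: cond_mean_def)
qed

text \<open>The martingale difference property. Given the past, each remaining position j in
  \<open>{k..n}\<close> contributes as much as position k, so averaging over j replaces
  \<open>cond_mean \<sigma> k\<close> by \<open>x (\<sigma> k)\<close>.\<close>

lemma sum_predictable_times_innov:
  assumes h: "predictable k h" and k: "k \<in> {1..n}"
  shows "(\<Sum>\<sigma>\<in>perms. h \<sigma> * innov \<sigma> k) = 0"
proof -
  let ?r = "real n + 1 - real k"
  let ?e = "\<Sum>\<sigma>\<in>perms. h \<sigma> * x (\<sigma> k)"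
  have "?r * (\<Sum>\<sigma>\<in>perms. h \<sigma> * cond_mean \<sigma> k) = (\<Sum>\<sigma>\<in>perms. h \<sigma> * (?r * cond_mean \<sigma> k))"
    by (simp add: sum_distrib_left mult_ac)
  also have "\<dots> = (\<Sum>\<sigma>\<in>perms. \<Sum>j = k..n. h \<sigma> * x (\<sigma> j))"
    using k by (intro sum.cong refl) (simp add: cond_mean_eq_mean_of_rest sum_distrib_left)
  also have "\<dots> = (\<Sum>j = k..n. \<Sum>\<sigma>\<in>perms. h \<sigma> * x (\<sigma> j))"
    by (rule sum.swap)
  also have "\<dots> = (\<Sum>j = k..n. ?e)"
    by (intro sum.cong refl sum_perms_exchange[OF h k])
  also have "\<dots> = ?r * ?e" using k by (simp add: of_nat_diff)
  finally have "(\<Sum>\<sigma>\<in>perms. h \<sigma> * cond_mean \<sigma> k) = ?e" using k by simp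
  then show ?thesis by (simp add: innov_def algebra_simps sum_subtractf)
qed

section \<open>Second moments of the martingale part, of its maximum and of the drift\<close>

lemma sum_x_squared:
  assumes k: "k \<in> {1..n}"
  shows "(\<Sum>\<sigma>\<in>perms. (x (\<sigma> k))\<^sup>2) = msq"
proof -
  let ?e = "\<lambda>j. \<Sum>\<sigma>\<in>perms. (x (\<sigma> j))\<^sup>2"
  have first: "?e j = ?e 1" if "j \<in> {1..n}" for j
    using sum_perms_exchange[of 1 "\<lambda>_. 1" j "\<lambda>i. (x i)\<^sup>2"] that by (simp add: predictable_def)
  have "real n * ?e 1 = (\<Sum>j = 1..n. ?e j)"
  proof -
    have "(\<Sum>j = 1..n. ?e j) = (\<Sum>j = 1..n. ?e 1)"
      by (intro sum.cong refl first)
    then show ?thesis by simp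
  qed
  also have "\<dots> = (\<Sum>\<sigma>\<in>perms. \<Sum>j = 1..n. (x (\<sigma> j))\<^sup>2)"
    by (rule sum.swap)
  also have "\<dots> = (\<Sum>\<sigma>\<in>perms. \<Sum>i = 1..n. (x i)\<^sup>2)"
  proof (rule sum.cong[OF refl])
    fix \<sigma> assume "\<sigma> \<in> perms"
    then show "(\<Sum>j = 1..n. (x (\<sigma> j))\<^sup>2) = (\<Sum>i = 1..n. (x i)\<^sup>2)"
      using sum.permute[of \<sigma> "{1..n}" "\<lambda>i. (x i)\<^sup>2"] by (simp add: comp_def)
  qed
  also have "\<dots> = fact n * (\<Sum>i = 1..n. (x i)\<^sup>2)"
    using card_permutations[of "{1..n}" n] by simp
  finally have "?e 1 = msq" using k by (simp add: msq_def field_simps)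
  then show ?thesis using first[OF k] by simp
qed

text \<open>Pythagoras: \<open>x (\<sigma> k)\<close> splits into the predictable
  \<open>cond_mean\<close> and the innovation orthogonal to it.\<close>

lemma sum_innov_squared_le:
  assumes k: "k \<in> {1..n}"
  shows "(\<Sum>\<sigma>\<in>perms. (innov \<sigma> k)\<^sup>2) \<le> msq"
proof -
  have "predictable k (\<lambda>\<sigma>. cond_mean \<sigma> k)"
    unfolding predictable_def by (blast intro: cond_mean_cong)
  then have orth: "(\<Sum>\<sigma>\<in>perms. cond_mean \<sigma> k * innov \<sigma> k) = 0"
    by (rule sum_predictable_times_innov[OF _ k])
  have "msq = (\<Sum>\<sigma>\<in>perms. (innov \<sigma> k)\<^sup>2 + 2 * (cond_mean \<sigma> k * innov \<sigma> k) + (cond_mean \<sigma> k)\<^sup>2)"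
    unfolding sum_x_squared[OF k, symmetric]
    by (intro sum.cong refl) (simp add: innov_def power2_eq_square algebra_simps)
  also have "\<dots> = (\<Sum>\<sigma>\<in>perms. (innov \<sigma> k)\<^sup>2) + (\<Sum>\<sigma>\<in>perms. (cond_mean \<sigma> k)\<^sup>2)"
    using orth by (simp add: sum.distrib flip: sum_distrib_left)
  finally show ?thesis by (simp add: sum_nonneg)
qed

text \<open>Each increment is orthogonal to the martingale before it, so the second moments add
  up.\<close>

lemma sum_mart_squared_le:
  "k \<le> n \<Longrightarrow> (\<Sum>\<sigma>\<in>perms. (mart c \<sigma> k)\<^sup>2) \<le> msq * (\<Sum>i = 1..k. (c i)\<^sup>2)"
proof (induction k)
  case 0
  show ?case by (simp add: mart_def)
next
  case (Suc k)
  have "predictable (Suc k) (\<lambda>\<sigma>. mart c \<sigma> k)"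
    unfolding predictable_def by (blast intro: mart_cong le_imp_less_Suc)
  then have orth: "(\<Sum>\<sigma>\<in>perms. mart c \<sigma> k * innov \<sigma> (Suc k)) = 0"
    using Suc.prems by (intro sum_predictable_times_innov) auto
  have "(\<Sum>\<sigma>\<in>perms. (mart c \<sigma> (Suc k))\<^sup>2)
      = (\<Sum>\<sigma>\<in>perms. (mart c \<sigma> k)\<^sup>2 + 2 * c (Suc k) * (mart c \<sigma> k * innov \<sigma> (Suc k))
          + (c (Suc k))\<^sup>2 * (innov \<sigma> (Suc k))\<^sup>2)"
    by (intro sum.cong refl) (simp add: mart_def power2_eq_square algebra_simps)
  also have "\<dots> = (\<Sum>\<sigma>\<in>perms. (mart c \<sigma> k)\<^sup>2) + (c (Suc k))\<^sup>2 * (\<Sum>\<sigma>\<in>perms. (innov \<sigma> (Suc k))\<^sup>2)"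
    using orth by (simp add: sum.distrib flip: sum_distrib_left)
  also have "\<dots> \<le> msq * (\<Sum>i = 1..k. (c i)\<^sup>2) + (c (Suc k))\<^sup>2 * msq"
    using Suc by (intro add_mono mult_left_mono sum_innov_squared_le) auto
  also have "\<dots> = msq * (\<Sum>i = 1..Suc k. (c i)\<^sup>2)"
    by (simp add: algebra_simps)
  finally show ?case .
qed

text \<open>Sum \<open>doob_pathwise\<close> over all permutations. The transform vanishes, since
  the running maximum and the sign at time i are predictable for time i + 1.\<close>

lemma doob_L2:
  assumes "k \<le> n"
  shows "(\<Sum>\<sigma>\<in>perms. (running_max (mart c \<sigma>) k)\<^sup>2) \<le> 4 * (\<Sum>\<sigma>\<in>perms. (mart c \<sigma> k)\<^sup>2)"
proof -
  let ?R = "\<lambda>\<sigma>. running_max (mart c \<sigma>)"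
  have orth: "(\<Sum>\<sigma>\<in>perms. ?R \<sigma> i * sgn (mart c \<sigma> i) * (mart c \<sigma> (Suc i) - mart c \<sigma> i)) = 0"
    if "i < k" for i
  proof -
    \<comment> \<open>The increment of \<open>mart\<close> is
      \<open>c (Suc i) * innov \<sigma> (Suc i)\<close>; its coefficient is moved into the
      predictable weight.\<close>
    have "predictable (Suc i) (\<lambda>\<sigma>. c (Suc i) * ?R \<sigma> i * sgn (mart c \<sigma> i))"
      unfolding predictable_def
    proof (intro allI impI)
      fix \<sigma> \<tau> :: "nat \<Rightarrow> nat" assume "\<forall>j<Suc i. \<sigma> j = \<tau> j"
      then have eq: "mart c \<sigma> j = mart c \<tau> j" if "j \<le> i" for j
        using that by (intro mart_cong) auto
      then have "?R \<sigma> i = ?R \<tau> i" by (rule running_max_cong)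
      with eq show "c (Suc i) * ?R \<sigma> i * sgn (mart c \<sigma> i) = c (Suc i) * ?R \<tau> i * sgn (mart c \<tau> i)"
        by simp
    qed
    then have "(\<Sum>\<sigma>\<in>perms. c (Suc i) * ?R \<sigma> i * sgn (mart c \<sigma> i) * innov \<sigma> (Suc i)) = 0"
      using that assms by (intro sum_predictable_times_innov) auto
    then show ?thesis by (simp add: mart_def mult_ac)
  qed
  have pathwise: "(?R \<sigma> k)\<^sup>2 \<le> 4 * (mart c \<sigma> k)\<^sup>2
      - 4 * (\<Sum>i<k. ?R \<sigma> i * sgn (mart c \<sigma> i) * (mart c \<sigma> (Suc i) - mart c \<sigma> i))" for \<sigma>
  proof -
    have "0 \<le> (?R \<sigma> k - 2 * \<bar>mart c \<sigma> k\<bar>)\<^sup>2" by simp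
    then have "4 * (?R \<sigma> k * \<bar>mart c \<sigma> k\<bar>) \<le> (?R \<sigma> k)\<^sup>2 + 4 * (mart c \<sigma> k)\<^sup>2"
      by (simp add: power2_diff power_mult_distrib)
    then show ?thesis using doob_pathwise[of "mart c \<sigma>" k] by linarith
  qed
  have "(\<Sum>\<sigma>\<in>perms. \<Sum>i<k. ?R \<sigma> i * sgn (mart c \<sigma> i) * (mart c \<sigma> (Suc i) - mart c \<sigma> i)) = 0"
    using orth by (subst sum.swap) simp
  moreover have "(\<Sum>\<sigma>\<in>perms. (?R \<sigma> k)\<^sup>2) \<le> (\<Sum>\<sigma>\<in>perms. 4 * (mart c \<sigma> k)\<^sup>2
      - 4 * (\<Sum>i<k. ?R \<sigma> i * sgn (mart c \<sigma> i) * (mart c \<sigma> (Suc i) - mart c \<sigma> i)))"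
    by (intro sum_mono pathwise)
  ultimately show ?thesis
    by (simp add: sum_subtractf flip: sum_distrib_left)
qed

text \<open>Drawing the i-th value changes the mean of the rest by -\<open>innov \<sigma> i\<close>
  / (n - i). The drift is thus itself a martingale of the form \<open>mart\<close>, and
  \<open>sum_mart_squared_le\<close> bounds its second moment.\<close>

lemma cond_mean_eq_mart:
  "k < n \<Longrightarrow> cond_mean \<sigma> (Suc k) = - mart (\<lambda>i. 1 / (real n - real i)) \<sigma> k"
proof (induction k)
  case 0
  show ?case by (simp add: cond_mean_def mart_def)
next
  case (Suc k)
  define T where "T = (\<Sum>j = 1..<Suc k. x (\<sigma> j))"
  define r where "r = real n - real k"
  have r: "r > 1" using Suc.prems by (simp add: r_def)
  have "cond_mean \<sigma> (Suc (Suc k)) = - (T + x (\<sigma> (Suc k))) / (r - 1)"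
    by (simp add: cond_mean_def T_def r_def)
  moreover have "cond_mean \<sigma> (Suc k) = - T / r"
    by (simp add: cond_mean_def T_def r_def)
  ultimately have "cond_mean \<sigma> (Suc (Suc k)) = cond_mean \<sigma> (Suc k) - innov \<sigma> (Suc k) / (r - 1)"
    using r by (simp add: innov_def field_simps)
  moreover have "real n - real (Suc k) = r - 1" by (simp add: r_def)
  ultimately show ?case using Suc by (simp add: mart_def)
qed

text \<open>Staying in the first half keeps the weights small: for i < k <= p one has n - i >= p, so
  at most p weights occur, each at most 1/p, and their squares sum to at most 1/p.\<close>

lemma sum_cond_mean_squared_le:
  assumes "k \<in> {1..p}" "2 * p \<le> n + 1"
  shows "(\<Sum>\<sigma>\<in>perms. (cond_mean \<sigma> k)\<^sup>2) \<le> msq / real p"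
proof -
  obtain l where l: "k = Suc l" using assms(1) by (cases k) auto
  have p: "p > 0" "l < n" "l \<le> p" using assms l by auto
  let ?c = "\<lambda>i. 1 / (real n - real i)"
  have "(\<Sum>i = 1..l. (?c i)\<^sup>2) \<le> (\<Sum>i = 1..l. (1 / real p)\<^sup>2)"
  proof (intro sum_mono power_mono)
    fix i assume "i \<in> {1..l}"
    then have "real p \<le> real n - real i" using assms l by auto
    then show "?c i \<le> 1 / real p" "0 \<le> ?c i" using p by (auto simp: field_simps)
  qed
  also have "\<dots> = real l * (1 / real p)\<^sup>2" by simp
  also have "\<dots> \<le> real p * (1 / real p)\<^sup>2"
    using p by (intro mult_right_mono) auto
  also have "\<dots> = 1 / real p" using p by (simp add: power2_eq_square)
  finally have "msq * (\<Sum>i = 1..l. (?c i)\<^sup>2) \<le> msq / real p"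
    using mult_left_mono[OF _ msq_nonneg] by fastforce
  moreover have "(\<Sum>\<sigma>\<in>perms. (cond_mean \<sigma> k)\<^sup>2) = (\<Sum>\<sigma>\<in>perms. (mart ?c \<sigma> l)\<^sup>2)"
    using p by (simp add: l cond_mean_eq_mart)
  moreover have "(\<Sum>\<sigma>\<in>perms. (mart ?c \<sigma> l)\<^sup>2) \<le> msq * (\<Sum>i = 1..l. (?c i)\<^sup>2)"
    using p by (intro sum_mart_squared_le) simp
  ultimately show ?thesis by linarith
qed

section \<open>The maximal inequality on the first half\<close>

lemma maximal_inequality_first_half:
  assumes "2 * p \<le> n + 1" "p \<le> n"
  shows "(\<Sum>\<sigma>\<in>perms. (running_max (psum c \<sigma>) p)\<^sup>2) \<le> 10 * msq * (\<Sum>i = 1..p. (c i)\<^sup>2)"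
proof -
  let ?Q = "\<Sum>i = 1..p. (c i)\<^sup>2"
  have Q: "0 \<le> ?Q" by (intro sum_nonneg) simp
  have pathwise: "(running_max (psum c \<sigma>) p)\<^sup>2
      \<le> 2 * (running_max (mart c \<sigma>) p)\<^sup>2 + 2 * (?Q * (\<Sum>i = 1..p. (cond_mean \<sigma> i)\<^sup>2))" for \<sigma>
  proof -
    obtain k where k: "k \<le> p" "running_max (psum c \<sigma>) p = \<bar>psum c \<sigma> k\<bar>"
      by (rule running_max_attained)
    define D where "D = (\<Sum>i = 1..k. c i * cond_mean \<sigma> i)"
    have "psum c \<sigma> k = mart c \<sigma> k + D"
      unfolding psum_def mart_def D_def innov_def by (simp add: algebra_simps flip: sum.distrib)
    moreover have "0 \<le> (mart c \<sigma> k - D)\<^sup>2" by simp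
    ultimately have "(psum c \<sigma> k)\<^sup>2 \<le> 2 * (mart c \<sigma> k)\<^sup>2 + 2 * D\<^sup>2"
      by (simp add: power2_eq_square algebra_simps)
    moreover have "(mart c \<sigma> k)\<^sup>2 \<le> (running_max (mart c \<sigma>) p)\<^sup>2"
      using power_mono[OF abs_le_running_max[OF k(1), of "mart c \<sigma>"] abs_ge_zero, of 2] by simp
    \<comment> \<open>The maximising index k depends on \<sigma>; extending both sums to p gives a
      bound free of k.\<close>
    moreover have "D\<^sup>2 \<le> ?Q * (\<Sum>i = 1..p. (cond_mean \<sigma> i)\<^sup>2)"
    proof -
      have "D\<^sup>2 \<le> (\<Sum>i = 1..k. (c i)\<^sup>2) * (\<Sum>i = 1..k. (cond_mean \<sigma> i)\<^sup>2)"
        unfolding D_def by (rule Cauchy_Schwarz_ineq_sum)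
      also have "\<dots> \<le> ?Q * (\<Sum>i = 1..p. (cond_mean \<sigma> i)\<^sup>2)"
        using k(1) by (intro mult_mono sum_mono2 sum_nonneg) auto
      finally show ?thesis .
    qed
    ultimately show ?thesis using k(2) by simp
  qed
  have "(\<Sum>\<sigma>\<in>perms. \<Sum>i = 1..p. (cond_mean \<sigma> i)\<^sup>2) = (\<Sum>i = 1..p. \<Sum>\<sigma>\<in>perms. (cond_mean \<sigma> i)\<^sup>2)"
    by (rule sum.swap)
  also have "\<dots> \<le> (\<Sum>i = 1..p. msq / real p)"
    using assms(1) by (intro sum_mono sum_cond_mean_squared_le)
  \<comment> \<open>For p = 0 the sum is empty; otherwise this is an equality.\<close>
  also have "\<dots> \<le> msq" using msq_nonneg by simp
  finally have drift: "?Q * (\<Sum>\<sigma>\<in>perms. \<Sum>i = 1..p. (cond_mean \<sigma> i)\<^sup>2) \<le> ?Q * msq"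
    using Q by (rule mult_left_mono)
  have "(\<Sum>\<sigma>\<in>perms. (running_max (psum c \<sigma>) p)\<^sup>2)
      \<le> (\<Sum>\<sigma>\<in>perms. 2 * (running_max (mart c \<sigma>) p)\<^sup>2 + 2 * (?Q * (\<Sum>i = 1..p. (cond_mean \<sigma> i)\<^sup>2)))"
    by (intro sum_mono pathwise)
  also have "\<dots> = 2 * (\<Sum>\<sigma>\<in>perms. (running_max (mart c \<sigma>) p)\<^sup>2)
      + 2 * (?Q * (\<Sum>\<sigma>\<in>perms. \<Sum>i = 1..p. (cond_mean \<sigma> i)\<^sup>2))"
    by (simp add: sum.distrib sum_distrib_left)
  \<comment> \<open>The constant is 10 = 2 * 4 + 2: Doob's factor 4 for the martingale and 1 for the
    drift, both doubled by splitting the square.\<close>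
  also have "\<dots> \<le> 2 * (4 * (msq * ?Q)) + 2 * (?Q * msq)"
    using doob_L2[OF assms(2), of c] sum_mart_squared_le[OF assms(2), of c] drift by linarith
  finally show ?thesis by (simp add: mult_ac)
qed

section \<open>Reversal and the maximal inequality on the whole range\<close>

definition reflect :: "nat \<Rightarrow> nat" where
  "reflect i = (if i \<in> {1..n} then n + 1 - i else i)"

lemma reflect_permutes: "reflect permutes {1..n}"
proof (rule bij_imp_permutes)
  show "bij_betw reflect {1..n} {1..n}"
    by (rule bij_betw_byWitness[where f' = reflect]) (auto simp: reflect_def)
qed (auto simp: reflect_def)

text \<open>Late partial sums become early ones of the reversed data, where the first-half bound
  applies.\<close>

lemma psum_tail:
  assumes "k \<le> n"
  shows "psum c \<sigma> n - psum c \<sigma> k = psum (c \<circ> reflect) (\<sigma> \<circ> reflect) (n - k)"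
proof -
  have "psum c \<sigma> n = psum c \<sigma> k + (\<Sum>i = k+1..n. c i * x (\<sigma> i))"
    using sum.ub_add_nat[of 1 k "\<lambda>i. c i * x (\<sigma> i)" "n - k"] assms by (simp add: psum_def)
  also have "(\<Sum>i = k+1..n. c i * x (\<sigma> i))
      = (\<Sum>i = 1..n-k. c (reflect i) * x (\<sigma> (reflect i)))"
    using assms by (intro sum.reindex_bij_witness[of _ reflect reflect]) (auto simp: reflect_def)
  finally show ?thesis by (simp add: psum_def)
qed

lemma maximal_inequality:
  "(\<Sum>\<sigma>\<in>perms. (running_max (psum c \<sigma>) n)\<^sup>2) \<le> 80 * msq * (\<Sum>i = 1..n. (c i)\<^sup>2)"
proof -
  \<comment> \<open>Both p and n - p must satisfy the first-half condition; for odd n the larger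
    half has 2 (n - p) = n + 1, exactly the limit.\<close>
  define p where "p = n div 2"
  have p: "2 * p \<le> n + 1" "2 * (n - p) \<le> n + 1" "p \<le> n" "n - p \<le> n"
    by (auto simp: p_def)
  let ?A = "\<lambda>\<sigma>. running_max (psum c \<sigma>) p"
  let ?B = "\<lambda>\<sigma>. running_max (psum (c \<circ> reflect) \<sigma>) (n - p)"
  have pathwise: "(running_max (psum c \<sigma>) n)\<^sup>2 \<le> 2 * (?A \<sigma>)\<^sup>2 + 8 * (?B (\<sigma> \<circ> reflect))\<^sup>2" for \<sigma>
  proof -
    let ?a = "?A \<sigma>" and ?b = "?B (\<sigma> \<circ> reflect)"
    obtain k where k: "k \<le> n" "running_max (psum c \<sigma>) n = \<bar>psum c \<sigma> k\<bar>"
      by (rule running_max_attained)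
    have tail: "\<bar>psum c \<sigma> n - psum c \<sigma> j\<bar> \<le> ?b" if "p \<le> j" "j \<le> n" for j
      unfolding psum_tail[OF that(2)] using that by (intro abs_le_running_max) simp
    have "\<bar>psum c \<sigma> k\<bar> \<le> ?a + 2 * ?b"
    proof (cases "k \<le> p")
      case True
      then have "\<bar>psum c \<sigma> k\<bar> \<le> ?a" by (rule abs_le_running_max)
      then show ?thesis
        using running_max_nonneg[of "psum (c \<circ> reflect) (\<sigma> \<circ> reflect)" "n - p"] by linarith
    next
      case False
      \<comment> \<open>Writing S for the partial sums, S_k = S_p + (S_n - S_p) - (S_n - S_k), with
        both differences being tails bounded by b.\<close>
      have "\<bar>psum c \<sigma> p\<bar> \<le> ?a" by (rule abs_le_running_max) simp
      moreover have "\<bar>psum c \<sigma> n - psum c \<sigma> p\<bar> \<le> ?b" "\<bar>psum c \<sigma> n - psum c \<sigma> k\<bar> \<le> ?b"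
        using False k(1) p(3) by (auto intro!: tail)
      ultimately show ?thesis by linarith
    qed
    then have "\<bar>psum c \<sigma> k\<bar>\<^sup>2 \<le> (?a + 2 * ?b)\<^sup>2" by (rule power_mono) simp
    also have "\<dots> \<le> 2 * ?a\<^sup>2 + 8 * ?b\<^sup>2"
      using zero_le_power2[of "?a - 2 * ?b"] by (simp add: power2_eq_square algebra_simps)
    finally show ?thesis using k(2) by simp
  qed
  have "(\<Sum>\<sigma>\<in>perms. (running_max (psum c \<sigma>) n)\<^sup>2)
      \<le> (\<Sum>\<sigma>\<in>perms. 2 * (?A \<sigma>)\<^sup>2 + 8 * (?B (\<sigma> \<circ> reflect))\<^sup>2)"
    by (intro sum_mono pathwise)
  also have "\<dots> = 2 * (\<Sum>\<sigma>\<in>perms. (?A \<sigma>)\<^sup>2) + 8 * (\<Sum>\<sigma>\<in>perms. (?B (\<sigma> \<circ> reflect))\<^sup>2)"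
    by (simp add: sum.distrib sum_distrib_left)
  also have "(\<Sum>\<sigma>\<in>perms. (?B (\<sigma> \<circ> reflect))\<^sup>2) = (\<Sum>\<sigma>\<in>perms. (?B \<sigma>)\<^sup>2)"
    by (rule sum_permutations_compose_right[OF reflect_permutes, symmetric])
  also have "2 * (\<Sum>\<sigma>\<in>perms. (?A \<sigma>)\<^sup>2) + 8 * (\<Sum>\<sigma>\<in>perms. (?B \<sigma>)\<^sup>2)
      \<le> 2 * (10 * msq * (\<Sum>i = 1..p. (c i)\<^sup>2)) + 8 * (10 * msq * (\<Sum>i = 1..n-p. ((c \<circ> reflect) i)\<^sup>2))"
    using p by (intro add_mono mult_left_mono maximal_inequality_first_half) auto
  also have "(\<Sum>i = 1..n-p. ((c \<circ> reflect) i)\<^sup>2) = (\<Sum>i = p+1..n. (c i)\<^sup>2)"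
    using p by (intro sum.reindex_bij_witness[of _ reflect reflect]) (auto simp: reflect_def)
  \<comment> \<open>The first block has the constant 20 and the second 80; raising 20 to 80 lets the
    blocks merge.\<close>
  also have "2 * (10 * msq * (\<Sum>i = 1..p. (c i)\<^sup>2)) + 8 * (10 * msq * (\<Sum>i = p+1..n. (c i)\<^sup>2))
      \<le> 80 * msq * ((\<Sum>i = 1..p. (c i)\<^sup>2) + (\<Sum>i = p+1..n. (c i)\<^sup>2))"
    using mult_nonneg_nonneg[OF msq_nonneg sum_nonneg[of "{1..p}" "\<lambda>i. (c i)\<^sup>2"]]
    by (simp add: algebra_simps)
  also have "(\<Sum>i = 1..p. (c i)\<^sup>2) + (\<Sum>i = p+1..n. (c i)\<^sup>2) = (\<Sum>i = 1..n. (c i)\<^sup>2)"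
    using sum.ub_add_nat[of 1 p "\<lambda>i. (c i)\<^sup>2" "n - p"] p by simp
  finally show ?thesis .
qed

end

theorem proposition9:
  fixes n :: nat and a x :: "nat \<Rightarrow> real"
  assumes "n \<ge> 2"
    and "(\<Sum>i = 1..n. x i) = 0"
  shows "1 / fact n * (\<Sum>\<sigma> | \<sigma> permutes {1..n}. MAX k \<in> {1..n}. \<bar>\<Sum>i = 1..k. a i * x (\<sigma> i)\<bar>\<^sup>2)
    \<le> (80 + 4 / 205) * (1 / (real n - 1)) * (\<Sum>i = 1..n. (a i)\<^sup>2) * (\<Sum>i = 1..n. (x i)\<^sup>2)"
proof -
  interpret centred_sequence n x using assms(2) by unfold_locales
  let ?A = "\<Sum>i = 1..n. (a i)\<^sup>2" and ?X = "\<Sum>i = 1..n. (x i)\<^sup>2"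
  \<comment> \<open>\<open>running_max\<close> also covers index 0, where the partial sum is empty,
    so it dominates the maximum over \<open>{1..n}\<close>.\<close>
  have "(MAX k \<in> {1..n}. \<bar>\<Sum>i = 1..k. a i * x (\<sigma> i)\<bar>\<^sup>2) \<le> (running_max (psum a \<sigma>) n)\<^sup>2" for \<sigma>
  proof (rule Max.boundedI)
    fix y assume "y \<in> (\<lambda>k. \<bar>\<Sum>i = 1..k. a i * x (\<sigma> i)\<bar>\<^sup>2) ` {1..n}"
    then show "y \<le> (running_max (psum a \<sigma>) n)\<^sup>2"
      unfolding psum_def[symmetric]
      by (blast intro: power_mono abs_le_running_max abs_ge_zero dest: atLeastAtMost_iff[THEN iffD1])
  qed (use assms(1) in auto)
  then have "(\<Sum>\<sigma>\<in>perms. MAX k \<in> {1..n}. \<bar>\<Sum>i = 1..k. a i * x (\<sigma> i)\<bar>\<^sup>2)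
      \<le> (\<Sum>\<sigma>\<in>perms. (running_max (psum a \<sigma>) n)\<^sup>2)"
    by (intro sum_mono)
  also have "\<dots> \<le> 80 * msq * ?A" by (rule maximal_inequality)
  finally have "1 / fact n * (\<Sum>\<sigma>\<in>perms. MAX k \<in> {1..n}. \<bar>\<Sum>i = 1..k. a i * x (\<sigma> i)\<bar>\<^sup>2)
      \<le> 1 / fact n * (80 * msq * ?A)"
    by (intro mult_left_mono) auto
  also have "\<dots> = 80 * (1 / real n) * (?A * ?X)" by (simp add: msq_def)
  \<comment> \<open>The bound obtained is 80/n; since n >= 2, it is below the claimed constant over
    n - 1.\<close>
  also have "\<dots> \<le> (80 + 4 / 205) * (1 / (real n - 1)) * (?A * ?X)"
    using assms(1) by (intro mult_right_mono mult_mono mult_nonneg_nonneg sum_nonneg)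
      (auto simp: field_simps)
  finally show ?thesis by (simp only: mult.assoc)
qed

end
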